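(* Let $\mathbf{G}\subset\mathbb{R}^n$ be a convex bounded open set with real algebraic boundary, with $0\in\mathbf{G}$ and $\mathbf{G}=\mathrm{int}\,\overline{\mathbf{G}}$, and assume some polynomial of degree at most $d$ vanishes on $\partial\mathbf{G}$ and not at $0$. Let $y_\alpha=\int_{\mathbf{G}}\mathbf{x}^\alpha d\mathbf{x}$. Then the system $\mathbf{M}^d_d(\mathbf{y})\begin{bmatrix}-1\\ \mathbf{g}\end{bmatrix}=0$ in $\mathbf{g}\in\mathbb{R}^{s(d)-1}$ has a solution, and for every solution $\mathbf{g}$ the polynomial $1-g$, where $g$ has coefficient vector $(0,\mathbf{g})$, vanishes on $\partial\mathbf{G}$.
   Context: $\mathbb{N}^n_k:=\{\alpha\in\mathbb{N}^n:|\alpha|\le k\}$, $s(d)=\binom{n+d}{n}$. The matrix $\mathbf{M}^d_d(\mathbf{y})$ has rows indexed by $\alpha\in\mathbb{N}^n_d$, columns by $\beta\in\mathbb{N}^n_d$ (first column $\beta=0$), entries $\frac{n+|\alpha|+|\beta|}{n+|\alpha|}y_{\alpha+\beta}$; so the system reads $-y_\alpha+\sum_{0<|\beta|\le d}\frac{n+|\alpha|+|\beta|}{n+|\alpha|}y_{\alpha+\beta}g_\beta=0$ for all $|\alpha|\le d$. *)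

theory Defs
  imports "HOL-Analysis.Analysis"
begin

text \<open>Multi-indices \<alpha> \<in> \<nat>^n are functions from the index type 'n to nat;
  points of \<real>^n are vectors of type real^'n, with n = CARD('n).\<close>

definition mdeg :: "('n::finite \<Rightarrow> nat) \<Rightarrow> nat" where
  "mdeg \<alpha> = (\<Sum>i\<in>UNIV. \<alpha> i)"

definition xmono :: "real^'n::finite \<Rightarrow> ('n \<Rightarrow> nat) \<Rightarrow> real" where
  "xmono x \<alpha> = (\<Prod>i\<in>UNIV. (x $ i) ^ (\<alpha> i))"

text \<open>\<nat>^n_k\<close>
definition midx :: "nat \<Rightarrow> ('n::finite \<Rightarrow> nat) set" where
  "midx k = {\<alpha>. mdeg \<alpha> \<le> k}"

definition zidx :: "'n \<Rightarrow> nat" where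
  "zidx = (\<lambda>_. 0)"

text \<open>Evaluation of a polynomial of degree at most k with coefficient function c
  (coefficients of monomials of degree > k are required to be zero separately).\<close>
definition peval :: "nat \<Rightarrow> (('n::finite \<Rightarrow> nat) \<Rightarrow> real) \<Rightarrow> real^'n \<Rightarrow> real" where
  "peval k c x = (\<Sum>\<alpha>\<in>midx k. c \<alpha> * xmono x \<alpha>)"

definition deg_le :: "nat \<Rightarrow> (('n::finite \<Rightarrow> nat) \<Rightarrow> real) \<Rightarrow> bool" where
  "deg_le k c \<longleftrightarrow> (\<forall>\<alpha>. k < mdeg \<alpha> \<longrightarrow> c \<alpha> = 0)"

text \<open>G has real algebraic boundary: \<partial>G is contained in the zero set of a nonzero polynomial.\<close>
definition algebraic_boundary :: "(real^'n::finite) set \<Rightarrow> bool" where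
  "algebraic_boundary G \<longleftrightarrow>
     (\<exists>D c. deg_le D c \<and> (\<exists>\<alpha>. c \<alpha> \<noteq> 0) \<and> (\<forall>x\<in>frontier G. peval D c x = 0))"

text \<open>Moments y_\<alpha> = \<integral>_G x^\<alpha> dx.\<close>
definition moment :: "(real^'n::finite) set \<Rightarrow> ('n \<Rightarrow> nat) \<Rightarrow> real" where
  "moment G \<alpha> = integral G (\<lambda>x. xmono x \<alpha>)"

text \<open>The linear system M^d_d(y) [-1; g] = 0, with unknowns g_\<beta> for 0 < |\<beta>| \<le> d.\<close>
definition moment_system :: "nat \<Rightarrow> (('n::finite \<Rightarrow> nat) \<Rightarrow> real) \<Rightarrow> (('n \<Rightarrow> nat) \<Rightarrow> real) \<Rightarrow> bool" where
  "moment_system d y g \<longleftrightarrow>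
     (\<forall>\<alpha>\<in>midx d. - y \<alpha> +
        (\<Sum>\<beta>\<in>midx d - {zidx}.
           real (CARD('n) + mdeg \<alpha> + mdeg \<beta>) / real (CARD('n) + mdeg \<alpha>)
             * y (\<lambda>i. \<alpha> i + \<beta> i) * g \<beta>) = 0)"

end

theory Submission
  imports Defs
begin

text \<open>
  For continuous \<open>F\<close> let \<open>\<phi>(t)\<close> be the integral of \<open>F\<close> over the dilation \<open>t G\<close>. Since \<open>G\<close> is
  convex with \<open>0 \<in> G\<close>, the shells \<open>G - t G\<close> (\<open>0 < t < 1\<close>) have volume \<open>(1 - t^n) |G|\<close> and shrink
  onto the boundary of \<open>G\<close>. Hence the left derivative of \<open>\<phi>\<close> at 1 vanishes when \<open>F\<close> vanishes on the
  boundary, and it is positive when \<open>F \<ge> 0\<close> is positive at a boundary point \<open>x0\<close>: the part of the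
  shell inside a thin cone around the ray through \<open>x0\<close> stays near \<open>x0\<close> and still has volume of
  order \<open>1 - t\<close>. For \<open>F(x) = \<Sum>\<^sub>i c\<^sub>i x^e\<^sub>i\<close> homogeneity gives \<open>\<phi>(t) = \<Sum>\<^sub>i c\<^sub>i t^(n + |e\<^sub>i|) y(e\<^sub>i)\<close>,
  so \<open>\<phi>'(1) = \<Sum>\<^sub>i c\<^sub>i (n + |e\<^sub>i|) y(e\<^sub>i)\<close>.

  Applied to \<open>x^\<alpha> p(x)\<close>, where \<open>p\<close> vanishes on the boundary and \<open>p(0) \<noteq> 0\<close>, this shows that
  \<open>-p/p(0)\<close> solves the moment system. If \<open>g\<close> is any solution, then \<open>q = [-1; g] + p/p(0)\<close> lies in
  the kernel of the moment matrix \<open>M\<close> (rows rescaled), so \<open>q\<^sup>T M q = 0\<close>; this is \<open>\<phi>'(1)\<close> for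
  \<open>F = q\<^sup>2 \<ge> 0\<close>, hence \<open>q\<close>, and with it \<open>1 - g\<close>, vanishes on the boundary.
\<close>

section \<open>Monomials\<close>

lemma continuous_on_xmono [continuous_intros]: "continuous_on A (\<lambda>x. xmono x \<alpha>)"
  unfolding xmono_def by (intro continuous_intros)

lemma xmono_scaleR: "xmono (t *\<^sub>R x) \<alpha> = t ^ mdeg \<alpha> * xmono x \<alpha>"
  unfolding xmono_def mdeg_def by (simp add: power_mult_distrib prod.distrib power_sum)

lemma xmono_add: "xmono x (\<lambda>i. \<alpha> i + \<beta> i) = xmono x \<alpha> * xmono x \<beta>"
  unfolding xmono_def by (simp add: power_add prod.distrib)

lemma mdeg_add: "mdeg (\<lambda>i. \<alpha> i + \<beta> i) = mdeg \<alpha> + mdeg \<beta>"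
  unfolding mdeg_def by (simp add: sum.distrib)

lemma xmono_zidx [simp]: "xmono x zidx = 1"
  unfolding xmono_def zidx_def by simp

lemma mdeg_zidx [simp]: "mdeg zidx = 0"
  unfolding mdeg_def zidx_def by simp

lemma add_zidx [simp]: "(\<lambda>i. \<alpha> i + zidx i) = \<alpha>"
  by (simp add: zidx_def)

lemma xmono_0: "xmono 0 \<alpha> = (if \<alpha> = zidx then 1 else 0)"
proof (cases "\<alpha> = zidx")
  case False
  then obtain i where "\<alpha> i \<noteq> 0" unfolding zidx_def by auto
  then show ?thesis using False by (auto simp: xmono_def prod_zero_iff)
qed simp

lemma zidx_in_midx [simp]: "zidx \<in> midx d"
  by (simp add: midx_def)

lemma finite_midx [simp]: "finite (midx d :: ('n::finite \<Rightarrow> nat) set)"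
proof (rule finite_subset)
  show "midx d \<subseteq> Pi\<^sub>E (UNIV :: 'n set) (\<lambda>_. {..d})"
  proof
    fix \<alpha> :: "'n \<Rightarrow> nat" assume "\<alpha> \<in> midx d"
    moreover have "\<alpha> i \<le> mdeg \<alpha>" for i
      unfolding mdeg_def by (rule member_le_sum) auto
    ultimately show "\<alpha> \<in> Pi\<^sub>E UNIV (\<lambda>_. {..d})"
      by (auto simp: midx_def intro: order_trans)
  qed
qed (simp add: finite_PiE)

lemma peval_0: "peval d p 0 = p zidx"
  unfolding peval_def xmono_0 by (simp add: if_distrib sum.delta cong: if_cong)

section \<open>Integrals over bounded Borel sets\<close>

lemma set_integrable_continuous_bounded:
  fixes f :: "'a::euclidean_space \<Rightarrow> real"
  assumes "bounded S" "S \<in> sets borel" "continuous_on UNIV f"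
  shows "set_integrable lborel S f"
proof (rule set_integrable_subset)
  show "set_integrable lborel (closure S) f"
    unfolding set_integrable_def using assms
    by (intro borel_integrable_compact) (auto simp: compact_closure intro: continuous_on_subset)
qed (use assms closure_subset in auto)

lemma mem_scaleR_image_iff:
  fixes S :: "'a::real_vector set"
  assumes "t \<noteq> 0"
  shows "x \<in> (*\<^sub>R) t ` S \<longleftrightarrow> inverse t *\<^sub>R x \<in> S"
  using assms by (auto simp: image_iff intro!: bexI[of _ "inverse t *\<^sub>R x"])

lemma sets_borel_scaleR_image:
  fixes S :: "'a::euclidean_space set"
  assumes "t \<noteq> 0" "S \<in> sets borel"
  shows "(*\<^sub>R) t ` S \<in> sets borel"
proof -
  have "(*\<^sub>R) t ` S = (\<lambda>x. inverse t *\<^sub>R x) -` S \<inter> space borel"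
    using mem_scaleR_image_iff[OF assms(1)] by auto
  also have "\<dots> \<in> sets borel"
    using assms(2) by measurable
  finally show ?thesis .
qed

lemma set_integral_scaleR_image:
  fixes f :: "'a::euclidean_space \<Rightarrow> real"
  assumes t: "t > 0" and S[measurable]: "S \<in> sets borel" and f[measurable]: "f \<in> borel_measurable borel"
  shows "(LINT x:(*\<^sub>R) t ` S|lborel. f x) = t ^ DIM('a) * (LINT x:S|lborel. f (t *\<^sub>R x))"
proof -
  have [measurable]: "(*\<^sub>R) t ` S \<in> sets borel"
    using assms by (intro sets_borel_scaleR_image) auto
  have "(LINT x:(*\<^sub>R) t ` S|lborel. f x)
      = t ^ DIM('a) * (\<integral>x. indicator ((*\<^sub>R) t ` S) (t *\<^sub>R x) * f (t *\<^sub>R x) \<partial>lborel)"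
    unfolding set_lebesgue_integral_def using t
    by (subst lborel_affine[of t 0]) (auto simp: integral_density integral_distr)
  also have "(\<lambda>x. indicator ((*\<^sub>R) t ` S) (t *\<^sub>R x) * f (t *\<^sub>R x)) = (\<lambda>x. indicator S x * f (t *\<^sub>R x))"
    using t by (auto simp: indicator_def fun_eq_iff)
  finally show ?thesis
    by (simp add: set_lebesgue_integral_def)
qed

lemma set_integral_Diff:
  fixes f :: "'a \<Rightarrow> real"
  assumes "set_integrable M A f" "A \<in> sets M" "B \<in> sets M" "B \<subseteq> A"
  shows "(LINT x:A|M. f x) - (LINT x:B|M. f x) = (LINT x:A - B|M. f x)"
proof -
  have "(LINT x:A|M. f x) = (LINT x:B \<union> (A - B)|M. f x)"
    using assms(4) by (simp add: Un_absorb1)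
  also have "\<dots> = (LINT x:B|M. f x) + (LINT x:A - B|M. f x)"
    using assms set_integrable_subset[OF assms(1)] by (intro set_integral_Un) auto
  finally show ?thesis by simp
qed

lemma set_integral_sum:
  fixes f :: "'i \<Rightarrow> 'a \<Rightarrow> real"
  assumes "\<And>i. i \<in> I \<Longrightarrow> set_integrable M A (f i)"
  shows "(LINT x:A|M. (\<Sum>i\<in>I. f i x)) = (\<Sum>i\<in>I. LINT x:A|M. f i x)"
  using assms unfolding set_lebesgue_integral_def set_integrable_def scaleR_sum_right
  by (rule Bochner_Integration.integral_sum)

lemma set_integral_abs_le_measure:
  fixes f :: "'a \<Rightarrow> real"
  assumes "set_integrable M A f" "A \<in> sets M" "emeasure M A \<noteq> \<infinity>"
    and "\<And>x. x \<in> A \<Longrightarrow> \<bar>f x\<bar> \<le> e"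
  shows "\<bar>LINT x:A|M. f x\<bar> \<le> e * measure M A"
proof -
  have "set_integrable M A (\<lambda>_. e)"
    using assms(2,3) by (simp add: set_integrable_def integrable_indicator_iff less_top)
  moreover have "set_integrable M A (\<lambda>x. \<bar>f x\<bar>)"
    using assms(1) by (rule set_integrable_abs)
  ultimately have "(LINT x:A|M. \<bar>f x\<bar>) \<le> (LINT x:A|M. e)"
    using assms(4) by (intro set_integral_mono)
  then have "\<bar>LINT x:A|M. f x\<bar> \<le> (LINT x:A|M. e)"
    using set_integral_norm_bound[OF assms(1)] by simp
  also have "\<dots> = e * measure M A"
    using assms(2,3) by (simp add: set_integral_const)
  finally show ?thesis .
qed

lemma measure_le_set_integral:
  fixes f :: "'a \<Rightarrow> real"
  assumes "set_integrable M A f" "A \<in> sets M" "emeasure M A \<noteq> \<infinity>"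
    and "\<And>x. x \<in> A \<Longrightarrow> e \<le> f x"
  shows "e * measure M A \<le> (LINT x:A|M. f x)"
proof -
  have "set_integrable M A (\<lambda>_. e)"
    using assms(2,3) by (simp add: set_integrable_def integrable_indicator_iff less_top)
  then have "(LINT x:A|M. e) \<le> (LINT x:A|M. f x)"
    using assms(1,4) by (rule set_integral_mono)
  then show ?thesis
    using assms(2,3) by (simp add: set_integral_const mult.commute)
qed

lemma set_integral_mono_set:
  fixes f :: "'a \<Rightarrow> real"
  assumes "set_integrable M A f" "A \<in> sets M" "B \<in> sets M" "B \<subseteq> A"
    and "\<And>x. x \<in> A \<Longrightarrow> 0 \<le> f x"
  shows "(LINT x:B|M. f x) \<le> (LINT x:A|M. f x)"
proof -
  have "0 \<le> (LINT x:A - B|M. f x)"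
    unfolding set_lebesgue_integral_def using assms(4,5)
    by (intro Bochner_Integration.integral_nonneg) (auto simp: indicator_def)
  then show ?thesis
    using set_integral_Diff[OF assms(1-4)] by simp
qed

lemma measure_scaleR_image:
  fixes S :: "'a::euclidean_space set"
  assumes "t > 0" "bounded S" "S \<in> sets borel"
  shows "measure lborel ((*\<^sub>R) t ` S) = t ^ DIM('a) * measure lborel S"
proof -
  have "bounded ((*\<^sub>R) t ` S)"
    using assms(2) by (rule bounded_scaling)
  moreover have "(*\<^sub>R) t ` S \<in> sets borel"
    using assms by (intro sets_borel_scaleR_image) auto
  ultimately show ?thesis
    using set_integral_scaleR_image[of t S "\<lambda>_. 1 :: real"] assms
      emeasure_bounded_finite[of S] emeasure_bounded_finite[of "(*\<^sub>R) t ` S"]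
    by (simp add: set_integral_const)
qed

lemma measure_lborel_open_pos:
  fixes A :: "'a::euclidean_space set"
  assumes "open A" "bounded A" "A \<noteq> {}"
  shows "0 < measure lborel A"
proof -
  obtain a r where r: "r > 0" "ball a r \<subseteq> A"
    using assms by (meson all_not_in_conv openE)
  have "0 < measure lborel (ball a r)"
    using r by (simp add: content_ball)
  also have "\<dots> \<le> measure lborel A"
    using r assms by (intro measure_mono_fmeasurable)
      (use emeasure_bounded_finite[OF assms(2)] in \<open>auto simp: fmeasurable_def\<close>)
  finally show ?thesis .
qed

section \<open>Integrals over dilations of a convex body\<close>

lemma scaleR_image_subset_convex:
  assumes "convex G" "0 \<in> G" "0 \<le> t" "t \<le> 1"
  shows "(*\<^sub>R) t ` G \<subseteq> G"
proof
  fix y assume "y \<in> (*\<^sub>R) t ` G"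
  then obtain x where x: "x \<in> G" "y = t *\<^sub>R x" by auto
  have "t *\<^sub>R x + (1 - t) *\<^sub>R 0 \<in> G"
    using assms x by (intro convexD) auto
  then show "y \<in> G" using x by simp
qed

definition dilation_integral :: "'a::euclidean_space set \<Rightarrow> ('a \<Rightarrow> real) \<Rightarrow> real \<Rightarrow> real" where
  "dilation_integral G F t = (LINT x:(*\<^sub>R) t ` G|lborel. F x)"

lemma dilation_integral_shell:
  fixes G :: "'a::euclidean_space set"
    and F :: "'a \<Rightarrow> real"
  assumes "bounded G" "G \<in> sets borel" "0 < t" "(*\<^sub>R) t ` G \<subseteq> G" "continuous_on UNIV F"
  shows "dilation_integral G F 1 - dilation_integral G F t = (LINT x:G - (*\<^sub>R) t ` G|lborel. F x)"
proof -
  have "(LINT x:G|lborel. F x) - (LINT x:(*\<^sub>R) t ` G|lborel. F x) = (LINT x:G - (*\<^sub>R) t ` G|lborel. F x)"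
    using assms sets_borel_scaleR_image[of t G]
    by (intro set_integral_Diff set_integrable_continuous_bounded) auto
  then show ?thesis
    by (simp add: dilation_integral_def)
qed

lemma measure_dilation_shell:
  fixes G :: "'a::euclidean_space set"
  assumes "bounded G" "G \<in> sets borel" "0 < t" "(*\<^sub>R) t ` G \<subseteq> G"
  shows "measure lborel (G - (*\<^sub>R) t ` G) = (1 - t ^ DIM('a)) * measure lborel G"
proof -
  have "measure lborel (G - (*\<^sub>R) t ` G) = measure lborel G - measure lborel ((*\<^sub>R) t ` G)"
    using assms emeasure_bounded_finite[OF assms(1)] sets_borel_scaleR_image[of t G]
    by (intro measure_Diff) auto
  then show ?thesis
    using measure_scaleR_image[OF assms(3,1,2)] by (simp add: algebra_simps)
qed

lemma frontier_near_dilation_shell: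
  fixes G :: "'a::euclidean_space set"
  assumes t: "0 < t" "t < 1" and x: "x \<in> G" "x \<notin> (*\<^sub>R) t ` G"
  shows "\<exists>y\<in>frontier G. dist x y \<le> (1 / t - 1) * norm x"
proof -
  let ?z = "inverse t *\<^sub>R x"
  have "?z \<notin> G"
    using x(2) t mem_scaleR_image_iff[of t x G] by simp
  then obtain y where y: "y \<in> closed_segment x ?z" "y \<in> frontier G"
    using connected_Int_frontier[of "closed_segment x ?z" G] x(1) by auto
  have "dist x y \<le> dist x ?z"
    using dist_in_closed_segment[OF y(1)] by (simp add: dist_commute)
  also have "x - ?z = (1 - inverse t) *\<^sub>R x"
    by (simp add: algebra_simps)
  then have "dist x ?z = \<bar>1 - inverse t\<bar> * norm x"
    by (simp add: dist_norm)
  also have "\<bar>1 - inverse t\<bar> = 1 / t - 1"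
    using t by (simp add: field_simps)
  finally show ?thesis
    using y(2) by blast
qed

lemma dilation_shell_eventually_small:
  fixes G :: "'a::euclidean_space set" and F :: "'a \<Rightarrow> real"
  assumes G: "bounded G" and F: "continuous_on UNIV F" "\<forall>x\<in>frontier G. F x = 0" and e: "e > 0"
  shows "\<forall>\<^sub>F t in at_left 1. \<forall>x\<in>G - (*\<^sub>R) t ` G. \<bar>F x\<bar> \<le> e"
proof -
  obtain R where R: "R > 0" "closure G \<subseteq> cball 0 R"
    using bounded_closure[OF G] by (auto simp: bounded_pos subset_iff)
  have "uniformly_continuous_on (cball 0 R) F"
    by (rule compact_uniformly_continuous) (use F in \<open>auto intro: continuous_on_subset\<close>)
  then obtain d where d: "d > 0"
    "\<And>x y. x \<in> cball 0 R \<Longrightarrow> y \<in> cball 0 R \<Longrightarrow> dist y x < d \<Longrightarrow> dist (F y) (F x) < e"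
    unfolding uniformly_continuous_on_def using e by metis
  have "((\<lambda>t. (1 / t - 1) * R) \<longlongrightarrow> (1 / 1 - 1) * R) (at_left 1)"
    by (intro tendsto_intros) auto
  then have "\<forall>\<^sub>F t in at_left 1. (1 / t - 1) * R < d"
    using d(1) by (intro order_tendstoD) auto
  moreover have "\<forall>\<^sub>F t in at_left 1. t \<in> {0::real<..<1}"
    by (rule eventually_at_left_real) simp
  ultimately show ?thesis
  proof eventually_elim
    case (elim t)
    show ?case
    proof
      fix x assume x: "x \<in> G - (*\<^sub>R) t ` G"
      then obtain y where y: "y \<in> frontier G" "dist x y \<le> (1 / t - 1) * norm x"
        using frontier_near_dilation_shell[of t x G] elim(2) by auto
      have xy: "x \<in> cball 0 R" "y \<in> cball 0 R"
        using x y(1) R(2) closure_subset[of G] by (auto simp: frontier_def)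
      have "(1 / t - 1) * norm x \<le> (1 / t - 1) * R"
        using elim(2) xy(1) by (intro mult_left_mono) (auto simp: field_simps)
      then have "dist (F x) (F y) < e"
        using d(2)[OF xy(2,1)] y(2) elim(1) by (simp add: dist_commute)
      then show "\<bar>F x\<bar> \<le> e"
        using F(2) y(1) by (simp add: dist_real_def)
    qed
  qed
qed

lemma dilation_integral_diff_abs_le:
  fixes G :: "'a::euclidean_space set" and F :: "'a \<Rightarrow> real"
  assumes G: "bounded G" "G \<in> sets borel" "(*\<^sub>R) t ` G \<subseteq> G" and t: "0 < t" "t < 1"
    and F: "continuous_on UNIV F" "\<forall>x\<in>G - (*\<^sub>R) t ` G. \<bar>F x\<bar> \<le> e" and e: "0 \<le> e"
  shows "\<bar>dilation_integral G F 1 - dilation_integral G F t\<bar> \<le> e * real DIM('a) * (1 - t) * measure lborel G"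
proof -
  have shell: "bounded (G - (*\<^sub>R) t ` G)" "G - (*\<^sub>R) t ` G \<in> sets borel"
    using G t sets_borel_scaleR_image[of t G] by auto
  have "\<bar>dilation_integral G F 1 - dilation_integral G F t\<bar> = \<bar>LINT x:G - (*\<^sub>R) t ` G|lborel. F x\<bar>"
    using G t F by (simp add: dilation_integral_shell)
  also have "\<dots> \<le> e * measure lborel (G - (*\<^sub>R) t ` G)"
    using shell F emeasure_bounded_finite[OF shell(1)]
    by (intro set_integral_abs_le_measure set_integrable_continuous_bounded) auto
  also have "\<dots> = e * ((1 - t ^ DIM('a)) * measure lborel G)"
    using G t by (simp add: measure_dilation_shell)
  also have "\<dots> \<le> e * (real DIM('a) * (1 - t) * measure lborel G)"
  proof -
    have "1 + real DIM('a) * (t - 1) \<le> (1 + (t - 1)) ^ DIM('a)"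
      by (rule Bernoulli_inequality) (use t in auto)
    then show ?thesis
      using e by (intro mult_left_mono mult_right_mono) (auto simp: algebra_simps)
  qed
  finally show ?thesis
    by (simp add: mult_ac)
qed

lemma dilation_integral_diff_ge:
  fixes E :: "'a::euclidean_space set" and F :: "'a \<Rightarrow> real"
  assumes E: "bounded E" "E \<in> sets borel" "(*\<^sub>R) t ` E \<subseteq> E" and t: "0 < t" "t < 1"
    and F: "continuous_on UNIV F" "\<forall>x\<in>E - (*\<^sub>R) t ` E. e \<le> F x" and e: "0 \<le> e"
  shows "e * (1 - t) * measure lborel E \<le> dilation_integral E F 1 - dilation_integral E F t"
proof -
  have shell: "bounded (E - (*\<^sub>R) t ` E)" "E - (*\<^sub>R) t ` E \<in> sets borel"
    using E t sets_borel_scaleR_image[of t E] by auto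
  have "t ^ DIM('a) \<le> t ^ 1"
    using t by (intro power_decreasing) auto
  then have "e * (1 - t) * measure lborel E \<le> e * ((1 - t ^ DIM('a)) * measure lborel E)"
    using e by (simp add: mult_left_mono mult_right_mono mult.assoc)
  also have "\<dots> = e * measure lborel (E - (*\<^sub>R) t ` E)"
    using E t by (simp add: measure_dilation_shell)
  also have "\<dots> \<le> (LINT x:E - (*\<^sub>R) t ` E|lborel. F x)"
    using shell F emeasure_bounded_finite[OF shell(1)]
    by (intro measure_le_set_integral set_integrable_continuous_bounded) auto
  also have "\<dots> = dilation_integral E F 1 - dilation_integral E F t"
    using E t F by (simp add: dilation_integral_shell)
  finally show ?thesis .
qed

lemma dilation_integral_diff_mono:
  fixes G :: "'a::euclidean_space set" and F :: "'a \<Rightarrow> real"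
  assumes G: "bounded G" "G \<in> sets borel" "(*\<^sub>R) t ` G \<subseteq> G"
    and E: "bounded E" "E \<in> sets borel" "(*\<^sub>R) t ` E \<subseteq> E" "E - (*\<^sub>R) t ` E \<subseteq> G - (*\<^sub>R) t ` G"
    and t: "0 < t" and F: "continuous_on UNIV F" "\<And>x. 0 \<le> F x"
  shows "dilation_integral E F 1 - dilation_integral E F t \<le> dilation_integral G F 1 - dilation_integral G F t"
proof -
  have "E - (*\<^sub>R) t ` E \<in> sets borel" "G - (*\<^sub>R) t ` G \<in> sets borel"
    using G E t sets_borel_scaleR_image[of t E] sets_borel_scaleR_image[of t G] by auto
  then have "(LINT x:E - (*\<^sub>R) t ` E|lborel. F x) \<le> (LINT x:G - (*\<^sub>R) t ` G|lborel. F x)"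
    using G E F by (intro set_integral_mono_set set_integrable_continuous_bounded) auto
  then show ?thesis
    using G E t F by (simp add: dilation_integral_shell)
qed

lemma dilation_integral_quotient_tendsto_0:
  fixes G :: "'a::euclidean_space set" and F :: "'a \<Rightarrow> real"
  assumes G: "convex G" "bounded G" "open G" "0 \<in> G"
    and F: "continuous_on UNIV F" "\<forall>x\<in>frontier G. F x = 0"
  shows "((\<lambda>t. (dilation_integral G F 1 - dilation_integral G F t) / (1 - t)) \<longlongrightarrow> 0) (at_left 1)"
proof (rule tendstoI)
  fix e :: real assume e: "e > 0"
  define K where "K = real DIM('a) * measure lborel G + 1"
  have K: "K > 0"
    unfolding K_def by (simp add: add_nonneg_pos)
  have "\<forall>\<^sub>F t in at_left 1. \<forall>x\<in>G - (*\<^sub>R) t ` G. \<bar>F x\<bar> \<le> e / (2 * K)"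
    using K e by (intro dilation_shell_eventually_small G F) auto
  moreover have "\<forall>\<^sub>F t in at_left 1. t \<in> {0::real<..<1}"
    by (rule eventually_at_left_real) simp
  ultimately show "\<forall>\<^sub>F t in at_left 1. dist ((dilation_integral G F 1 - dilation_integral G F t) / (1 - t)) 0 < e"
  proof eventually_elim
    case (elim t)
    have "(*\<^sub>R) t ` G \<subseteq> G"
      using elim(2) G by (intro scaleR_image_subset_convex) auto
    then have "\<bar>dilation_integral G F 1 - dilation_integral G F t\<bar>
        \<le> e / (2 * K) * real DIM('a) * (1 - t) * measure lborel G"
      using G elim K e F(1) by (intro dilation_integral_diff_abs_le) auto
    also have "\<dots> \<le> e / 2 * (1 - t)"
      using elim(2) e K by (simp add: K_def field_simps)
    finally have "\<bar>(dilation_integral G F 1 - dilation_integral G F t) / (1 - t)\<bar> \<le> e / 2"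
      using elim(2) by (simp add: abs_div divide_le_eq)
    then show ?case
      unfolding dist_real_def diff_zero using e by linarith
  qed
qed

section \<open>Thin cones at a boundary point\<close>

lemma convex_scaled_outward_notin:
  fixes G :: "'a::real_normed_vector set"
  assumes G: "convex G" "ball 0 \<rho> \<subseteq> G" "x0 \<notin> G"
    and s: "0 < s" "s < 1" and b: "dist x0 b < (1 - s) * \<rho>"
  shows "inverse s *\<^sub>R b \<notin> G"
proof
  assume w: "inverse s *\<^sub>R b \<in> G"
  define v where "v = inverse (1 - s) *\<^sub>R (x0 - b)"
  have "norm v = dist x0 b / (1 - s)"
    using s by (simp add: v_def dist_norm divide_inverse_commute)
  also have "\<dots> < \<rho>"
    using s b by (simp add: field_simps)
  finally have "v \<in> G"
    using G(2) by auto
  have "x0 = s *\<^sub>R (inverse s *\<^sub>R b) + (1 - s) *\<^sub>R v"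
    using s by (simp add: v_def)
  also have "\<dots> \<in> G"
    using G(1) w \<open>v \<in> G\<close> s by (intro convexD) auto
  finally show False
    using G(3) by simp
qed

lemma convex_scaled_inward_mem:
  fixes G :: "'a::euclidean_space set"
  assumes G: "convex G" "open G" "ball 0 \<rho> \<subseteq> G" "x0 \<in> closure G"
    and \<tau>: "0 < \<tau>" "\<tau> < 1" and b: "dist x0 b < (1 - \<tau>) * \<rho>"
  shows "\<tau> *\<^sub>R b \<in> G"
proof -
  define v where "v = (\<tau> / (1 - \<tau>)) *\<^sub>R (b - x0)"
  have "norm v = \<tau> * (dist x0 b / (1 - \<tau>))"
    using \<tau> by (simp add: v_def dist_norm norm_minus_commute)
  also have "\<dots> < \<tau> * \<rho>"
    using \<tau> b by (intro mult_strict_left_mono) (auto simp: field_simps)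
  also have "\<dots> \<le> \<rho>"
  proof -
    have "0 < (1 - \<tau>) * \<rho>"
      using b zero_le_dist[of x0 b] by linarith
    then show ?thesis
      using \<tau> by (intro mult_left_le_one_le) (auto simp: zero_less_mult_iff)
  qed
  finally have "v \<in> interior G"
    using G(2,3) by (auto simp: interior_open)
  then have "x0 - (1 - \<tau>) *\<^sub>R (x0 - v) \<in> interior G"
    using G(1,4) \<tau> by (intro mem_interior_closure_convex_shrink) auto
  moreover have "(1 - \<tau>) *\<^sub>R v = \<tau> *\<^sub>R (b - x0)"
    using \<tau> by (simp add: v_def)
  then have "x0 - (1 - \<tau>) *\<^sub>R (x0 - v) = \<tau> *\<^sub>R b"
    by (simp add: algebra_simps)
  ultimately show ?thesis
    using interior_subset by auto
qed

definition positive_cone :: "'a::real_vector set \<Rightarrow> 'a set" where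
  "positive_cone S = (\<Union>u\<in>{0<..}. (*\<^sub>R) u ` S)"

lemma mem_positive_cone_iff: "x \<in> positive_cone S \<longleftrightarrow> (\<exists>u>0. \<exists>b\<in>S. x = u *\<^sub>R b)"
  unfolding positive_cone_def by blast

lemma subset_positive_cone: "S \<subseteq> positive_cone S"
proof
  fix x assume "x \<in> S"
  then show "x \<in> positive_cone S"
    unfolding mem_positive_cone_iff by (intro exI[of _ 1]) auto
qed

lemma open_positive_cone:
  fixes S :: "'a::real_normed_vector set"
  shows "open S \<Longrightarrow> open (positive_cone S)"
  unfolding positive_cone_def by (intro open_UN ballI open_scaling) auto

lemma scaleR_mem_positive_cone_iff:
  assumes s: "0 < s"
  shows "s *\<^sub>R x \<in> positive_cone S \<longleftrightarrow> x \<in> positive_cone S"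
proof
  assume "s *\<^sub>R x \<in> positive_cone S"
  then obtain u b where ub: "u > 0" "b \<in> S" "s *\<^sub>R x = u *\<^sub>R b"
    unfolding mem_positive_cone_iff by blast
  have "x = inverse s *\<^sub>R (s *\<^sub>R x)"
    using s by simp
  also have "\<dots> = (u / s) *\<^sub>R b"
    using ub(3) by (simp add: divide_inverse_commute)
  finally show "x \<in> positive_cone S"
    using ub s unfolding mem_positive_cone_iff by (intro exI[of _ "u / s"]) auto
next
  assume "x \<in> positive_cone S"
  then obtain u b where "u > 0" "b \<in> S" "x = u *\<^sub>R b"
    unfolding mem_positive_cone_iff by blast
  then show "s *\<^sub>R x \<in> positive_cone S"
    using s unfolding mem_positive_cone_iff by (intro exI[of _ "s * u"]) auto
qed

lemma dilation_shell_cone_scale_bounds: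
  fixes G :: "'a::euclidean_space set"
  assumes G: "convex G" "open G" "ball 0 \<rho> \<subseteq> G" and x0: "x0 \<in> frontier G"
    and \<kappa>: "0 < \<kappa>" "\<kappa> < 1" and b: "dist x0 b < (1 - \<kappa>) * \<rho>"
    and t: "0 < t" and u: "0 < u" and x: "u *\<^sub>R b \<in> G" "u *\<^sub>R b \<notin> (*\<^sub>R) t ` G"
  shows "t * \<kappa> < u" "u * \<kappa> < 1"
proof -
  have "0 < (1 - \<kappa>) * \<rho>"
    using b zero_le_dist[of x0 b] by linarith
  then have \<rho>: "0 < \<rho>"
    using \<kappa> by (simp add: zero_less_mult_iff)
  show "u * \<kappa> < 1"
  proof (rule ccontr)
    assume "\<not> u * \<kappa> < 1"
    then have s: "0 < inverse u" "inverse u \<le> \<kappa>"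
      using u \<kappa> by (auto simp: field_simps)
    have "dist x0 b < (1 - inverse u) * \<rho>"
      using b s \<rho> by (smt (verit) mult_right_mono)
    then have "inverse (inverse u) *\<^sub>R b \<notin> G"
      using G x0 s \<kappa> by (intro convex_scaled_outward_notin) (auto simp: frontier_def interior_open)
    then show False
      using x(1) by simp
  qed
  show "t * \<kappa> < u"
  proof (rule ccontr)
    assume "\<not> t * \<kappa> < u"
    then have \<tau>: "0 < u / t" "u / t \<le> \<kappa>"
      using u t by (auto simp: field_simps)
    have "dist x0 b < (1 - u / t) * \<rho>"
      using b \<tau> \<rho> by (smt (verit) mult_right_mono)
    then have "(u / t) *\<^sub>R b \<in> G"
      using G x0 \<tau> \<kappa> by (intro convex_scaled_inward_mem) (auto simp: frontier_def)
    moreover have "u *\<^sub>R b = t *\<^sub>R ((u / t) *\<^sub>R b)"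
      using t by simp
    ultimately show False
      using x(2) by blast
  qed
qed

lemma dilation_shell_cone_dist_le:
  fixes G :: "'a::euclidean_space set"
  assumes G: "convex G" "open G" "ball 0 \<rho> \<subseteq> G" and x0: "x0 \<in> frontier G"
    and \<kappa>: "0 < \<kappa>" "\<kappa> < 1" and t: "0 < t" "t < 1"
    and x: "x \<in> G \<inter> positive_cone (ball x0 ((1 - \<kappa>) * \<rho>)) - (*\<^sub>R) t ` G"
  shows "dist x x0 \<le> (1 - \<kappa>) * \<rho> / \<kappa> + (1 / \<kappa> - t * \<kappa>) * norm x0"
proof -
  have "x \<in> positive_cone (ball x0 ((1 - \<kappa>) * \<rho>))"
    using x by blast
  then obtain u b where ub: "u > 0" "dist x0 b < (1 - \<kappa>) * \<rho>" "x = u *\<^sub>R b"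
    unfolding mem_positive_cone_iff by auto
  have u: "t * \<kappa> < u" "u < 1 / \<kappa>"
    using dilation_shell_cone_scale_bounds[OF G x0 \<kappa> ub(2) t(1) ub(1)] x ub(3) \<kappa>
    by (auto simp: field_simps)
  have "dist x x0 \<le> norm (u *\<^sub>R (b - x0)) + norm ((u - 1) *\<^sub>R x0)"
    using norm_triangle_ineq[of "u *\<^sub>R (b - x0)" "(u - 1) *\<^sub>R x0"] ub(3)
    by (simp add: dist_norm algebra_simps)
  also have "\<dots> = u * dist x0 b + \<bar>u - 1\<bar> * norm x0"
    using ub(1) by (simp add: dist_norm norm_minus_commute)
  also have "\<dots> \<le> (1 - \<kappa>) * \<rho> / \<kappa> + (1 / \<kappa> - t * \<kappa>) * norm x0"
  proof (rule add_mono)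
    have "u * dist x0 b \<le> u * ((1 - \<kappa>) * \<rho>)"
      using ub by (intro mult_left_mono) auto
    also have "\<dots> \<le> (1 - \<kappa>) * \<rho> / \<kappa>"
      using u(2) mult_right_mono[of u "1 / \<kappa>" "(1 - \<kappa>) * \<rho>"] ub(2) zero_le_dist[of x0 b] by simp
    finally show "u * dist x0 b \<le> (1 - \<kappa>) * \<rho> / \<kappa>" .
    have "t * \<kappa> \<le> 1" "1 \<le> 1 / \<kappa>"
      using t \<kappa> by (auto simp: field_simps mult_le_one)
    then have "\<bar>u - 1\<bar> \<le> 1 / \<kappa> - t * \<kappa>"
      using u by linarith
    then show "\<bar>u - 1\<bar> * norm x0 \<le> (1 / \<kappa> - t * \<kappa>) * norm x0"
      by (rule mult_right_mono) simp
  qed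
  finally show ?thesis .
qed

lemma dilation_shell_eventually_near_in_cone:
  fixes G :: "'a::euclidean_space set"
  assumes G: "convex G" "open G" "0 \<in> G" and x0: "x0 \<in> frontier G" and r: "r > 0"
  obtains \<delta> where "\<delta> > 0"
    "\<forall>\<^sub>F t in at_left 1. \<forall>x\<in>G \<inter> positive_cone (ball x0 \<delta>) - (*\<^sub>R) t ` G. dist x x0 < r"
proof -
  obtain \<rho> where \<rho>: "\<rho> > 0" "ball 0 \<rho> \<subseteq> G"
    using G(2,3) openE by blast
  \<comment> \<open>the bound of \<open>dilation_shell_cone_dist_le\<close> at \<open>t = 1\<close>; it tends to 0 as the cone gets thinner\<close>
  define f where "f \<kappa> = (1 - \<kappa>) * \<rho> / \<kappa> + (1 / \<kappa> - \<kappa>) * norm x0" for \<kappa> :: real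
  have "(f \<longlongrightarrow> f 1) (at_left 1)"
    unfolding f_def by (intro tendsto_intros) auto
  moreover have "f 1 < r / 2"
    using r by (simp add: f_def)
  ultimately have "\<forall>\<^sub>F \<kappa> in at_left 1. f \<kappa> < r / 2"
    by (rule order_tendstoD(2))
  moreover have "\<forall>\<^sub>F \<kappa> in at_left 1. \<kappa> \<in> {0::real<..<1}"
    by (rule eventually_at_left_real) simp
  ultimately obtain \<kappa> where \<kappa>: "0 < \<kappa>" "\<kappa> < 1" "f \<kappa> < r / 2"
    using eventually_happens'[OF trivial_limit_at_left_real eventually_conj] by force
  have "((\<lambda>t. \<kappa> * (1 - t) * norm x0) \<longlongrightarrow> \<kappa> * (1 - 1) * norm x0) (at_left 1)"
    by (intro tendsto_intros)
  then have "\<forall>\<^sub>F t in at_left 1. \<kappa> * (1 - t) * norm x0 < r / 2"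
    using r by (intro order_tendstoD) auto
  moreover have "\<forall>\<^sub>F t in at_left 1. t \<in> {0::real<..<1}"
    by (rule eventually_at_left_real) simp
  ultimately have "\<forall>\<^sub>F t in at_left 1. \<forall>x\<in>G \<inter> positive_cone (ball x0 ((1 - \<kappa>) * \<rho>)) - (*\<^sub>R) t ` G. dist x x0 < r"
  proof eventually_elim
    case (elim t)
    have "(1 - \<kappa>) * \<rho> / \<kappa> + (1 / \<kappa> - t * \<kappa>) * norm x0 = f \<kappa> + \<kappa> * (1 - t) * norm x0"
      using \<kappa> by (simp add: f_def algebra_simps)
    then show ?case
      using dilation_shell_cone_dist_le[OF G(1,2) \<rho>(2) x0 \<kappa>(1,2)] elim \<kappa>(3) by fastforce
  qed
  moreover have "(1 - \<kappa>) * \<rho> > 0"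
    using \<kappa> \<rho> by simp
  ultimately show ?thesis
    using that by blast
qed

lemma dilation_integral_quotient_eventually_pos:
  fixes G :: "'a::euclidean_space set" and F :: "'a \<Rightarrow> real"
  assumes G: "convex G" "bounded G" "open G" "0 \<in> G"
    and F: "continuous_on UNIV F" "\<And>x. 0 \<le> F x"
    and x0: "x0 \<in> frontier G" "F x0 > 0"
  shows "\<exists>c>0. \<forall>\<^sub>F t in at_left 1. c \<le> (dilation_integral G F 1 - dilation_integral G F t) / (1 - t)"
proof -
  define e where "e = F x0 / 2"
  have e: "e > 0"
    using x0(2) by (simp add: e_def)
  obtain r where r: "r > 0" "\<And>x. dist x x0 < r \<Longrightarrow> dist (F x) (F x0) < e"
    using F(1) e unfolding continuous_on_iff by blast
  have F_ge: "e \<le> F x" if "dist x x0 < r" for x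
  proof -
    have "\<bar>F x - F x0\<bar> < e"
      using r(2)[OF that] by (simp add: dist_real_def)
    then show ?thesis
      unfolding abs_less_iff e_def by linarith
  qed
  obtain \<delta> where \<delta>: "\<delta> > 0"
    and near: "\<forall>\<^sub>F t in at_left 1. \<forall>x\<in>G \<inter> positive_cone (ball x0 \<delta>) - (*\<^sub>R) t ` G. dist x x0 < r"
    using dilation_shell_eventually_near_in_cone[OF G(1,3,4) x0(1) r(1)] by blast
  define E where "E = G \<inter> positive_cone (ball x0 \<delta>)"
  have E: "open E" "bounded E" "E \<in> sets borel"
    using G by (auto simp: E_def open_positive_cone)
  have "E \<noteq> {}"
  proof -
    obtain y where "y \<in> G" "dist x0 y < \<delta>"
      using x0(1) \<delta> unfolding frontier_straddle by blast
    then show ?thesis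
      using subset_positive_cone[of "ball x0 \<delta>"] by (auto simp: E_def)
  qed
  then have vol_E: "measure lborel E > 0"
    using E by (intro measure_lborel_open_pos)
  have "\<forall>\<^sub>F t in at_left 1. t \<in> {0::real<..<1}"
    by (rule eventually_at_left_real) simp
  with near have "\<forall>\<^sub>F t in at_left 1. e * measure lborel E \<le> (dilation_integral G F 1 - dilation_integral G F t) / (1 - t)"
  proof eventually_elim
    case (elim t)
    have subG: "(*\<^sub>R) t ` G \<subseteq> G"
      using elim(2) G by (intro scaleR_image_subset_convex) auto
    have subE: "(*\<^sub>R) t ` E \<subseteq> E"
      using subG scaleR_mem_positive_cone_iff[of t] elim(2) by (auto simp: E_def)
    have shell: "E - (*\<^sub>R) t ` E \<subseteq> G \<inter> positive_cone (ball x0 \<delta>) - (*\<^sub>R) t ` G"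
      using scaleR_mem_positive_cone_iff[of t] elim(2) by (auto simp: E_def)
    have "e * (1 - t) * measure lborel E \<le> dilation_integral E F 1 - dilation_integral E F t"
      using E subE elim shell F_ge F(1) e by (intro dilation_integral_diff_ge) auto
    also have "\<dots> \<le> dilation_integral G F 1 - dilation_integral G F t"
      using G E subG subE shell elim(2) F by (intro dilation_integral_diff_mono) auto
    finally show ?case
      using elim(2) by (simp add: field_simps)
  qed
  then show ?thesis
    using e vol_E by (intro exI[of _ "e * measure lborel E"]) auto
qed

section \<open>Polynomial integrands\<close>

lemma moment_eq_set_integral:
  fixes G :: "(real^'n::finite) set"
  assumes "bounded G" "G \<in> sets borel"
  shows "moment G \<alpha> = (LINT x:G|lborel. xmono x \<alpha>)"
  unfolding moment_def using assms
  by (intro set_borel_integral_eq_integral(2)[symmetric] set_integrable_continuous_bounded)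
    (auto intro: continuous_intros)

lemma dilation_integral_monomials:
  fixes G :: "(real^'n::finite) set"
  assumes G: "bounded G" "G \<in> sets borel" and I: "finite I" and t: "0 < t"
  shows "dilation_integral G (\<lambda>x. \<Sum>i\<in>I. c i * xmono x (e i)) t
       = (\<Sum>i\<in>I. c i * t ^ (CARD('n) + mdeg (e i)) * moment G (e i))"
proof -
  have "dilation_integral G (\<lambda>x. \<Sum>i\<in>I. c i * xmono x (e i)) t
      = t ^ CARD('n) * (LINT x:G|lborel. (\<Sum>i\<in>I. (c i * t ^ mdeg (e i)) * xmono x (e i)))"
    unfolding dilation_integral_def using G t
    by (subst set_integral_scaleR_image)
      (auto intro!: borel_measurable_continuous_onI continuous_intros simp: xmono_scaleR mult_ac)
  also have "\<dots> = t ^ CARD('n) * (\<Sum>i\<in>I. (c i * t ^ mdeg (e i)) * (LINT x:G|lborel. xmono x (e i)))"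
    using G by (subst set_integral_sum)
      (auto intro!: set_integrable_mult_right set_integrable_continuous_bounded continuous_on_xmono)
  finally show ?thesis
    using G by (simp add: moment_eq_set_integral sum_distrib_left power_add mult_ac)
qed

lemma has_real_derivative_imp_left_quotient_tendsto:
  assumes "(f has_real_derivative L) (at x)"
  shows "((\<lambda>t. (f x - f t) / (x - t)) \<longlongrightarrow> L) (at_left x)"
proof -
  have "((\<lambda>t. (f t - f x) / (t - x)) \<longlongrightarrow> L) (at x)"
    using assms by (simp add: has_field_derivative_iff)
  then have "((\<lambda>t. (f t - f x) / (t - x)) \<longlongrightarrow> L) (at_left x)"
    by (rule tendsto_mono[rotated]) (simp add: at_le)
  moreover have "(f t - f x) / (t - x) = (f x - f t) / (x - t)" for t
    by (simp add: divide_simps) (auto simp: algebra_simps)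
  ultimately show ?thesis
    by simp
qed

lemma dilation_integral_monomials_quotient_tendsto:
  fixes G :: "(real^'n::finite) set" and c :: "'i \<Rightarrow> real" and e :: "'i \<Rightarrow> 'n \<Rightarrow> nat"
  assumes G: "bounded G" "G \<in> sets borel" and I: "finite I"
  defines "F \<equiv> \<lambda>x. \<Sum>i\<in>I. c i * xmono x (e i)"
  shows "((\<lambda>t. (dilation_integral G F 1 - dilation_integral G F t) / (1 - t))
           \<longlongrightarrow> (\<Sum>i\<in>I. c i * real (CARD('n) + mdeg (e i)) * moment G (e i))) (at_left 1)"
proof -
  define P where "P t = (\<Sum>i\<in>I. c i * t ^ (CARD('n) + mdeg (e i)) * moment G (e i))" for t :: real
  have "(P has_real_derivative (\<Sum>i\<in>I. c i * real (CARD('n) + mdeg (e i)) * moment G (e i))) (at 1)"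
  proof -
    have "(P has_real_derivative (\<Sum>i\<in>I. c i * (real (CARD('n) + mdeg (e i)) * 1 ^ (CARD('n) + mdeg (e i) - 1)) * moment G (e i))) (at 1)"
      unfolding P_def by (intro derivative_eq_intros DERIV_sum) auto
    then show ?thesis by simp
  qed
  then have "((\<lambda>t. (P 1 - P t) / (1 - t)) \<longlongrightarrow> (\<Sum>i\<in>I. c i * real (CARD('n) + mdeg (e i)) * moment G (e i))) (at_left 1)"
    by (rule has_real_derivative_imp_left_quotient_tendsto)
  moreover have "\<forall>\<^sub>F t in at_left 1. (P 1 - P t) / (1 - t) = (dilation_integral G F 1 - dilation_integral G F t) / (1 - t)"
    using eventually_at_left_real[OF zero_less_one]
    by eventually_elim (simp add: F_def P_def dilation_integral_monomials[OF G I])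
  ultimately show ?thesis
    by (rule Lim_transform_eventually)
qed

lemma moment_identity_of_frontier_vanishing:
  fixes G :: "(real^'n::finite) set"
  assumes G: "convex G" "bounded G" "open G" "0 \<in> G" and I: "finite I"
    and vanish: "\<forall>x\<in>frontier G. (\<Sum>i\<in>I. c i * xmono x (e i)) = 0"
  shows "(\<Sum>i\<in>I. c i * real (CARD('n) + mdeg (e i)) * moment G (e i)) = 0"
proof -
  let ?F = "\<lambda>x. \<Sum>i\<in>I. c i * xmono x (e i)"
  have "continuous_on UNIV ?F"
    by (intro continuous_intros)
  then have lim_0: "((\<lambda>t. (dilation_integral G ?F 1 - dilation_integral G ?F t) / (1 - t)) \<longlongrightarrow> 0) (at_left 1)"
    by (rule dilation_integral_quotient_tendsto_0[OF G _ vanish])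
  have G_sets: "G \<in> sets borel"
    using G(3) by simp
  from tendsto_unique[OF _ dilation_integral_monomials_quotient_tendsto[OF G(2) G_sets I] lim_0]
  show ?thesis
    by simp
qed

lemma frontier_vanishing_of_moment_identity:
  fixes G :: "(real^'n::finite) set"
  assumes G: "convex G" "bounded G" "open G" "0 \<in> G" and I: "finite I"
    and nonneg: "\<And>x. 0 \<le> (\<Sum>i\<in>I. c i * xmono x (e i))"
    and moments: "(\<Sum>i\<in>I. c i * real (CARD('n) + mdeg (e i)) * moment G (e i)) = 0"
    and x0: "x0 \<in> frontier G"
  shows "(\<Sum>i\<in>I. c i * xmono x0 (e i)) = 0"
proof (rule ccontr)
  let ?F = "\<lambda>x. \<Sum>i\<in>I. c i * xmono x (e i)"
  assume "?F x0 \<noteq> 0"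
  then have pos: "?F x0 > 0"
    using nonneg[of x0] by linarith
  have "continuous_on UNIV ?F"
    by (intro continuous_intros)
  then obtain a where "a > 0"
    and ev: "\<forall>\<^sub>F t in at_left 1. a \<le> (dilation_integral G ?F 1 - dilation_integral G ?F t) / (1 - t)"
    using dilation_integral_quotient_eventually_pos[of G ?F x0, OF G _ nonneg x0 pos] by blast
  have "G \<in> sets borel"
    using G(3) by simp
  then have "((\<lambda>t. (dilation_integral G ?F 1 - dilation_integral G ?F t) / (1 - t)) \<longlongrightarrow> 0) (at_left 1)"
    using dilation_integral_monomials_quotient_tendsto[OF G(2) _ I, of c e] moments by simp
  from tendsto_lowerbound[OF this ev] have "a \<le> 0"
    by simp
  then show False
    using \<open>a > 0\<close> by simp
qed

section \<open>The moment system\<close>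

text \<open>The \<open>\<alpha>\<close>-row of \<open>M\<^sup>d\<^sub>d(y)\<close> multiplied by \<open>n + |\<alpha>|\<close>; when \<open>y\<close> are the moments of \<open>G\<close>,
  its value at \<open>c\<close> is \<open>\<phi>'(1)\<close> for \<open>F(x) = x^\<alpha> c(x)\<close>.\<close>

definition moment_kernel :: "nat \<Rightarrow> (('n::finite \<Rightarrow> nat) \<Rightarrow> real) \<Rightarrow> (('n \<Rightarrow> nat) \<Rightarrow> real) \<Rightarrow> bool" where
  "moment_kernel d y c \<longleftrightarrow>
     (\<forall>\<alpha>\<in>midx d. (\<Sum>\<beta>\<in>midx d. real (CARD('n) + mdeg \<alpha> + mdeg \<beta>) * y (\<lambda>i. \<alpha> i + \<beta> i) * c \<beta>) = 0)"

text \<open>The vector \<open>[-1; g]\<close> to which \<open>M\<^sup>d\<^sub>d(y)\<close> is applied.\<close>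

definition system_vector :: "(('n \<Rightarrow> nat) \<Rightarrow> real) \<Rightarrow> ('n \<Rightarrow> nat) \<Rightarrow> real" where
  "system_vector g \<beta> = (if \<beta> = zidx then -1 else g \<beta>)"

lemma sum_midx_split:
  "(\<Sum>\<beta>\<in>midx d. f \<beta>) = f zidx + (\<Sum>\<beta>\<in>midx d - {zidx}. f \<beta>)"
  by (rule sum.remove) auto

lemma moment_system_iff_moment_kernel:
  fixes g :: "('n::finite \<Rightarrow> nat) \<Rightarrow> real"
  shows "moment_system d y g \<longleftrightarrow> moment_kernel d y (system_vector g)"
proof -
  have pos: "real (CARD('n) + mdeg \<alpha>) > 0" for \<alpha> :: "'n \<Rightarrow> nat"
    by (simp add: card_gt_0_iff add_pos_nonneg)
  have row: "(\<Sum>\<beta>\<in>midx d. real (CARD('n) + mdeg \<alpha> + mdeg \<beta>) * y (\<lambda>i. \<alpha> i + \<beta> i) * system_vector g \<beta>)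
      = real (CARD('n) + mdeg \<alpha>) * (- y \<alpha> + (\<Sum>\<beta>\<in>midx d - {zidx}.
          real (CARD('n) + mdeg \<alpha> + mdeg \<beta>) / real (CARD('n) + mdeg \<alpha>) * y (\<lambda>i. \<alpha> i + \<beta> i) * g \<beta>))"
    for \<alpha> :: "'n \<Rightarrow> nat"
    unfolding sum_midx_split[of _ d] distrib_left sum_distrib_left
    using pos[of \<alpha>] by (auto simp: system_vector_def intro!: sum.cong)
  show ?thesis
    unfolding moment_system_def moment_kernel_def row
    using pos by (simp del: of_nat_add)
qed

lemma moment_kernel_add:
  "moment_kernel d y c \<Longrightarrow> moment_kernel d y c' \<Longrightarrow> moment_kernel d y (\<lambda>\<beta>. c \<beta> + c' \<beta>)"
  by (simp add: moment_kernel_def distrib_left sum.distrib)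

lemma moment_kernel_scale:
  assumes "moment_kernel d y c"
  shows "moment_kernel d y (\<lambda>\<beta>. a * c \<beta>)"
proof -
  have "(\<Sum>\<beta>\<in>midx d. w \<beta> * (a * c \<beta>)) = a * (\<Sum>\<beta>\<in>midx d. w \<beta> * c \<beta>)" for w :: "_ \<Rightarrow> real"
    by (simp add: sum_distrib_left mult_ac)
  then show ?thesis
    using assms by (simp add: moment_kernel_def)
qed

lemma moment_kernel_of_frontier_vanishing:
  fixes G :: "(real^'n::finite) set"
  assumes G: "convex G" "bounded G" "open G" "0 \<in> G"
    and vanish: "\<forall>x\<in>frontier G. peval d p x = 0"
  shows "moment_kernel d (moment G) p"
  unfolding moment_kernel_def
proof
  fix \<alpha> :: "'n \<Rightarrow> nat"
  have "\<forall>x\<in>frontier G. (\<Sum>\<beta>\<in>midx d. p \<beta> * xmono x (\<lambda>i. \<alpha> i + \<beta> i)) = 0"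
  proof
    fix x assume "x \<in> frontier G"
    have "(\<Sum>\<beta>\<in>midx d. p \<beta> * xmono x (\<lambda>i. \<alpha> i + \<beta> i)) = xmono x \<alpha> * peval d p x"
      unfolding peval_def xmono_add sum_distrib_left by (simp add: mult_ac)
    then show "(\<Sum>\<beta>\<in>midx d. p \<beta> * xmono x (\<lambda>i. \<alpha> i + \<beta> i)) = 0"
      using vanish \<open>x \<in> frontier G\<close> by simp
  qed
  from moment_identity_of_frontier_vanishing[OF G finite_midx this]
  show "(\<Sum>\<beta>\<in>midx d. real (CARD('n) + mdeg \<alpha> + mdeg \<beta>) * moment G (\<lambda>i. \<alpha> i + \<beta> i) * p \<beta>) = 0"
    by (simp add: mdeg_add mult_ac add.assoc)
qed

lemma frontier_vanishing_of_moment_kernel: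
  fixes G :: "(real^'n::finite) set"
  assumes G: "convex G" "bounded G" "open G" "0 \<in> G"
    and ker: "moment_kernel d (moment G) q" and x0: "x0 \<in> frontier G"
  shows "peval d q x0 = 0"
proof -
  have square: "(\<Sum>ab\<in>midx d \<times> midx d. (q (fst ab) * q (snd ab)) * xmono x (\<lambda>i. fst ab i + snd ab i))
      = (peval d q x)\<^sup>2" for x
    unfolding peval_def power2_eq_square sum_product sum.cartesian_product xmono_add
    by (intro sum.cong) (auto simp: mult_ac)
  have "(\<Sum>ab\<in>midx d \<times> midx d. (q (fst ab) * q (snd ab))
          * real (CARD('n) + mdeg (\<lambda>i. fst ab i + snd ab i)) * moment G (\<lambda>i. fst ab i + snd ab i))
      = (\<Sum>\<alpha>\<in>midx d. q \<alpha> * (\<Sum>\<beta>\<in>midx d. real (CARD('n) + mdeg \<alpha> + mdeg \<beta>)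
          * moment G (\<lambda>i. \<alpha> i + \<beta> i) * q \<beta>))"
    unfolding sum_distrib_left sum.cartesian_product
    by (simp add: split_beta mdeg_add mult_ac add.assoc)
  also have "\<dots> = 0"
    using ker by (simp add: moment_kernel_def)
  finally have "(\<Sum>ab\<in>midx d \<times> midx d. (q (fst ab) * q (snd ab)) * xmono x0 (\<lambda>i. fst ab i + snd ab i)) = 0"
    using G x0 square by (intro frontier_vanishing_of_moment_identity) auto
  then show ?thesis
    using square by simp
qed

lemma peval_system_vector:
  "peval d (system_vector g) x = (\<Sum>\<beta>\<in>midx d - {zidx}. g \<beta> * xmono x \<beta>) - 1"
  unfolding peval_def sum_midx_split[of _ d]
  by (auto simp: system_vector_def intro!: sum.cong)

lemma moment_system_of_moment_kernel:
  assumes ker: "moment_kernel d y p" and p0: "p zidx \<noteq> 0"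
  shows "moment_system d y (\<lambda>\<beta>. - p \<beta> / p zidx)"
proof -
  have "system_vector (\<lambda>\<beta>. - p \<beta> / p zidx) = (\<lambda>\<beta>. (- 1 / p zidx) * p \<beta>)"
    unfolding system_vector_def using p0 by (intro ext) auto
  then have "moment_kernel d y (system_vector (\<lambda>\<beta>. - p \<beta> / p zidx))"
    using moment_kernel_scale[OF ker, of "- 1 / p zidx"] by (simp only:)
  then show ?thesis
    by (simp add: moment_system_iff_moment_kernel)
qed

lemma frontier_vanishing_of_moment_system:
  fixes G :: "(real^'n::finite) set"
  assumes G: "convex G" "bounded G" "open G" "0 \<in> G"
    and p: "moment_kernel d (moment G) p" "p zidx \<noteq> 0" "\<forall>x\<in>frontier G. peval d p x = 0"
    and g: "moment_system d (moment G) g" and x: "x \<in> frontier G"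
  shows "peval d (system_vector g) x = 0"
proof -
  define q where "q \<beta> = system_vector g \<beta> + (1 / p zidx) * p \<beta>" for \<beta>
  have "moment_kernel d (moment G) q"
    unfolding q_def using g p(1)
    by (intro moment_kernel_add moment_kernel_scale) (simp_all add: moment_system_iff_moment_kernel)
  then have "peval d q x = 0"
    using G x by (intro frontier_vanishing_of_moment_kernel)
  moreover have "peval d q x = peval d (system_vector g) x + (1 / p zidx) * peval d p x"
    unfolding peval_def q_def by (simp add: sum.distrib sum_distrib_left algebra_simps)
  ultimately show ?thesis
    using p(3) x by simp
qed

theorem corollary2:
  fixes G :: "(real^'n::finite) set" and d :: nat
  assumes "convex G" and "bounded G" and "open G"
    and "algebraic_boundary G"
    and "0 \<in> G" and "interior (closure G) = G"
    and "\<exists>p. deg_le d p \<and> (\<forall>x\<in>frontier G. peval d p x = 0) \<and> peval d p 0 \<noteq> 0"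
  shows "(\<exists>g. moment_system d (moment G) g) \<and>
         (\<forall>g. moment_system d (moment G) g \<longrightarrow>
              (\<forall>x\<in>frontier G. 1 - (\<Sum>\<beta>\<in>midx d - {zidx}. g \<beta> * xmono x \<beta>) = 0))"
proof -
  note G = assms(1,2,3,5)
  obtain p where p_vanish: "\<forall>x\<in>frontier G. peval d p x = 0" and p0: "p zidx \<noteq> 0"
    using assms(7) peval_0 by metis
  have ker_p: "moment_kernel d (moment G) p"
    using G p_vanish by (rule moment_kernel_of_frontier_vanishing)
  have "1 - (\<Sum>\<beta>\<in>midx d - {zidx}. g \<beta> * xmono x \<beta>) = 0"
    if "moment_system d (moment G) g" "x \<in> frontier G" for g x
    using frontier_vanishing_of_moment_system[OF G ker_p p0 p_vanish that]
    by (simp add: peval_system_vector)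
  with moment_system_of_moment_kernel[OF ker_p p0] show ?thesis
    by blast
qed

end
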